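(* Let $K$ be a field, $f\in K[[x]]=K[[x_1,\dots,x_r]]$, $g\in K[[y]]=K[[y_1,\dots,y_s]]$ nonzero. The three variants $\widehat{\otimes}'$, $\widehat{\otimes}''$ and $\widehat{\otimes}'''$ of Yoshino's tensor product are functorial operations: for each $\boxtimes\in\{\widehat{\otimes}',\widehat{\otimes}'',\widehat{\otimes}'''\}$, and for fixed $X_f\in MF(K[[x]],f)$ and $X_g\in MF(K[[y]],g)$, the operation $X_f\boxtimes(-)$ defines a functor $MF(K[[y]],g)\to MF(K[[x,y]],f+g)$ and the operation $(-)\boxtimes X_g$ defines a functor $MF(K[[x]],f)\to MF(K[[x,y]],f+g)$.
   Context: For a power series ring $R$ over $K$ and $f\in R$, an $n\times n$ matrix factorization of $f$ (of size $n$) is a pair $(\phi,\psi)$ of $n\times n$ matrices over $R$ with $\phi\psi=\psi\phi=fI_n$. The category $MF(R,f)$ has as objects the matrix factorizations of $f$ (of all sizes); a morphism $(\phi_1,\psi_1)\to(\phi_2,\psi_2)$ between factorizations of sizes $n_1,n_2$ is a pair $(\alpha,\beta)$ of $n_2\times n_1$ matrices over $R$ with $\alpha\phi_1=\phi_2\beta$ and $\psi_2\alpha=\beta\psi_1$; composition and identities are componentwise. For $X=(\phi,\psi)\in MF(K[[x]],f)$ of size $n$ and $X'=(\phi',\psi')\in MF(K[[y]],g)$ of size $m$, with matrices regarded over $K[[x,y]]$, $\otimes$ the Kronecker product and $1_k$ the $k\times k$ identity matrix, the variants are the following objects of $MF(K[[x,y]],f+g)$ of size $2nm$: $$X\widehat{\otimes}'X'=\left(\begin{bmatrix}1_n\otimes\phi'&\psi\otimes1_m\\\phi\otimes1_m&-1_n\otimes\psi'\end{bmatrix},\begin{bmatrix}1_n\otimes\psi'&\psi\otimes1_m\\\phi\otimes1_m&-1_n\otimes\phi'\end{bmatrix}\right),$$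 $$X\widehat{\otimes}''X'=\left(\begin{bmatrix}\psi\otimes1_m&-1_n\otimes\psi'\\1_n\otimes\phi'&\phi\otimes1_m\end{bmatrix},\begin{bmatrix}\phi\otimes1_m&1_n\otimes\psi'\\-1_n\otimes\phi'&\psi\otimes1_m\end{bmatrix}\right),$$ $$X\widehat{\otimes}'''X'=\left(\begin{bmatrix}-1_n\otimes\psi'&\phi\otimes1_m\\\psi\otimes1_m&1_n\otimes\phi'\end{bmatrix},\begin{bmatrix}-1_n\otimes\phi'&\phi\otimes1_m\\\psi\otimes1_m&1_n\otimes\psi'\end{bmatrix}\right).$$ "Defines a functor" means that the given assignment on objects is the object part of a functor. *)

theory Defs
  imports "Jordan_Normal_Form.Matrix"
begin

section \<open>Formal power series in several variables\<close>

text \<open>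
  \<open>('v, 'k) mps\<close> is the ring \<open>K[[x\<^sub>v | v]]\<close> with one variable for each element of the finite type
  \<open>'v\<close>. A monomial is given by its exponent function \<open>'v \<Rightarrow> nat\<close>, which has finite support
  because \<open>'v\<close> is finite.
\<close>

typedef ('v, 'k) mps = "UNIV :: (('v \<Rightarrow> nat) \<Rightarrow> 'k) set"
  morphisms mps_coeff Abs_mps ..

setup_lifting type_definition_mps

definition monomial_splits :: "('v \<Rightarrow> nat) \<Rightarrow> (('v \<Rightarrow> nat) \<times> ('v \<Rightarrow> nat)) set" where
  "monomial_splits m = {(a, b). (\<lambda>i. a i + b i) = m}"

lemma finite_monomial_splits [simp]: "finite (monomial_splits (m :: 'v::finite \<Rightarrow> nat))"
proof -
  have "finite (PiE UNIV (\<lambda>i. {..m i}))"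
    by (intro finite_PiE) auto
  then have fin: "finite {a. \<forall>i. a i \<le> m i}"
    by (simp add: PiE_def Pi_def extensional_def)
  have "monomial_splits m \<subseteq> {a. \<forall>i. a i \<le> m i} \<times> {a. \<forall>i. a i \<le> m i}"
    by (auto simp: monomial_splits_def)
  then show ?thesis
    using fin finite_subset by blast
qed

lemma mps_eqI: "(\<And>m. mps_coeff p m = mps_coeff q m) \<Longrightarrow> p = q"
  by (transfer) auto

instantiation mps :: (finite, comm_ring_1) comm_ring_1
begin

lift_definition zero_mps :: "('a, 'b) mps" is "\<lambda>m. 0" .

lift_definition one_mps :: "('a, 'b) mps" is "\<lambda>m. if m = (\<lambda>i. 0) then 1 else 0" .

lift_definition plus_mps :: "('a, 'b) mps \<Rightarrow> ('a, 'b) mps \<Rightarrow> ('a, 'b) mps" is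
  "\<lambda>p q m. p m + q m" .

lift_definition minus_mps :: "('a, 'b) mps \<Rightarrow> ('a, 'b) mps \<Rightarrow> ('a, 'b) mps" is
  "\<lambda>p q m. p m - q m" .

lift_definition uminus_mps :: "('a, 'b) mps \<Rightarrow> ('a, 'b) mps" is
  "\<lambda>p m. - p m" .

lift_definition times_mps :: "('a, 'b) mps \<Rightarrow> ('a, 'b) mps \<Rightarrow> ('a, 'b) mps" is
  "\<lambda>p q m. \<Sum>(a, b)\<in>monomial_splits m. p a * q b" .

instance
proof
  fix p q r :: "('a, 'b) mps"
  show "p * q * r = p * (q * r)"
  proof (rule mps_eqI)
    fix m :: "'a \<Rightarrow> nat"
    have "mps_coeff (p * q * r) m = (\<Sum>(s, c)\<in>monomial_splits m. \<Sum>(a, b)\<in>monomial_splits s.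
        mps_coeff p a * mps_coeff q b * mps_coeff r c)"
      by (simp add: times_mps.rep_eq sum_distrib_right case_prod_unfold)
    also have "\<dots> = (\<Sum>(x, y)\<in>Sigma (monomial_splits m) (\<lambda>x. monomial_splits (fst x)).
        mps_coeff p (fst y) * mps_coeff q (snd y) * mps_coeff r (snd x))"
      by (subst sum.Sigma [symmetric]) (auto simp: case_prod_unfold)
    also have "\<dots> = (\<Sum>(x, y)\<in>Sigma (monomial_splits m) (\<lambda>x. monomial_splits (snd x)).
        mps_coeff p (fst x) * mps_coeff q (fst y) * mps_coeff r (snd y))"
      by (rule sum.reindex_bij_witness
            [where j = "\<lambda>(x, y). ((fst y, \<lambda>i. snd y i + snd x i), (snd y, snd x))"
               and i = "\<lambda>(x, y). ((\<lambda>i. fst x i + fst y i, snd y), (fst x, fst y))"])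
         (auto simp: monomial_splits_def add.assoc)
    also have "\<dots> = (\<Sum>(a, s)\<in>monomial_splits m. \<Sum>(b, c)\<in>monomial_splits s.
        mps_coeff p a * mps_coeff q b * mps_coeff r c)"
      by (subst sum.Sigma [symmetric]) (auto simp: case_prod_unfold)
    also have "\<dots> = mps_coeff (p * (q * r)) m"
      by (simp add: times_mps.rep_eq sum_distrib_left case_prod_unfold mult.assoc)
    finally show "mps_coeff (p * q * r) m = mps_coeff (p * (q * r)) m" .
  qed
  show "p * q = q * p"
  proof (rule mps_eqI)
    fix m :: "'a \<Rightarrow> nat"
    show "mps_coeff (p * q) m = mps_coeff (q * p) m"
      unfolding times_mps.rep_eq
      by (rule sum.reindex_bij_witness [where j = "\<lambda>(a, b). (b, a)" and i = "\<lambda>(a, b). (b, a)"])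
         (auto simp: monomial_splits_def add.commute mult.commute)
  qed
  show "1 * p = p"
  proof (rule mps_eqI)
    fix m :: "'a \<Rightarrow> nat"
    have "mps_coeff (1 * p) m = (\<Sum>x\<in>monomial_splits m.
        if x = (\<lambda>i. 0, m) then mps_coeff p m else 0)"
      unfolding times_mps.rep_eq one_mps.rep_eq
      by (intro sum.cong) (auto simp: monomial_splits_def split: if_splits)
    also have "\<dots> = mps_coeff p m"
      by (subst sum.delta) (simp, simp add: monomial_splits_def)
    finally show "mps_coeff (1 * p) m = mps_coeff p m" .
  qed
  show "(p + q) * r = p * r + q * r"
    by (rule mps_eqI)
       (simp add: times_mps.rep_eq plus_mps.rep_eq distrib_right case_prod_unfold sum.distrib)
  show "(0 :: ('a, 'b) mps) \<noteq> 1"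
    by transfer (metis zero_neq_one)
qed (transfer; simp add: fun_eq_iff algebra_simps)+

end

text \<open>
  The embedding of \<open>K[[x\<^sub>v | v]]\<close> into \<open>K[[y\<^sub>w | w]]\<close> sending \<open>x\<^sub>v\<close> to \<open>y\<^bsub>\<iota> v\<^esub>\<close>, for \<open>\<iota>\<close> injective:
  monomials involving a variable outside the range of \<open>\<iota>\<close> get coefficient zero. With the variables
  of \<open>K[[x,y]]\<close> indexed by a sum type, \<open>\<iota>\<close> is \<open>Inl\<close> for \<open>K[[x]]\<close> and \<open>Inr\<close> for \<open>K[[y]]\<close>.
\<close>

lift_definition mps_embed :: "('v \<Rightarrow> 'w) \<Rightarrow> ('v, 'k::zero) mps \<Rightarrow> ('w, 'k) mps" is
  "\<lambda>\<iota> p m. if \<forall>j. j \<notin> range \<iota> \<longrightarrow> m j = 0 then p (m \<circ> \<iota>) else 0" .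


section \<open>Categories and functors\<close>

text \<open>
  Hom-sets need not be disjoint: the same pair of matrices may be a morphism between several pairs
  of objects. Hence the morphism part of a functor takes source and target as arguments.
\<close>

record ('o, 'm) cat =
  Obj :: "'o set"
  Hom :: "'o \<Rightarrow> 'o \<Rightarrow> 'm set"
  Ident :: "'o \<Rightarrow> 'm"
  Comp :: "'m \<Rightarrow> 'm \<Rightarrow> 'm"

locale category =
  fixes C :: "('o, 'm) cat"
  assumes ident_in_Hom: "X \<in> Obj C \<Longrightarrow> Ident C X \<in> Hom C X X"
    and Comp_in_Hom:
      "\<lbrakk>X \<in> Obj C; Y \<in> Obj C; Z \<in> Obj C; u \<in> Hom C X Y; v \<in> Hom C Y Z\<rbrakk>
        \<Longrightarrow> Comp C v u \<in> Hom C X Z"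
    and Comp_ident_right:
      "\<lbrakk>X \<in> Obj C; Y \<in> Obj C; u \<in> Hom C X Y\<rbrakk> \<Longrightarrow> Comp C u (Ident C X) = u"
    and Comp_ident_left:
      "\<lbrakk>X \<in> Obj C; Y \<in> Obj C; u \<in> Hom C X Y\<rbrakk> \<Longrightarrow> Comp C (Ident C Y) u = u"
    and Comp_assoc:
      "\<lbrakk>W \<in> Obj C; X \<in> Obj C; Y \<in> Obj C; Z \<in> Obj C;
        u \<in> Hom C W X; v \<in> Hom C X Y; w \<in> Hom C Y Z\<rbrakk>
        \<Longrightarrow> Comp C w (Comp C v u) = Comp C (Comp C w v) u"

locale cat_functor = dom: category C + cod: category D
  for C :: "('o, 'm) cat" and D :: "('p, 'n) cat" +
  fixes F_obj :: "'o \<Rightarrow> 'p" and F_mor :: "'o \<Rightarrow> 'o \<Rightarrow> 'm \<Rightarrow> 'n"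
  assumes F_obj_in_Obj: "X \<in> Obj C \<Longrightarrow> F_obj X \<in> Obj D"
    and F_mor_in_Hom:
      "\<lbrakk>X \<in> Obj C; Y \<in> Obj C; u \<in> Hom C X Y\<rbrakk> \<Longrightarrow> F_mor X Y u \<in> Hom D (F_obj X) (F_obj Y)"
    and F_mor_ident: "X \<in> Obj C \<Longrightarrow> F_mor X X (Ident C X) = Ident D (F_obj X)"
    and F_mor_Comp:
      "\<lbrakk>X \<in> Obj C; Y \<in> Obj C; Z \<in> Obj C; u \<in> Hom C X Y; v \<in> Hom C Y Z\<rbrakk>
        \<Longrightarrow> F_mor X Z (Comp C v u) = Comp D (F_mor Y Z v) (F_mor X Y u)"

definition defines_functor ::
  "('o, 'm) cat \<Rightarrow> ('p, 'n) cat \<Rightarrow> ('o \<Rightarrow> 'p) \<Rightarrow> bool" where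
  "defines_functor C D F_obj \<longleftrightarrow> (\<exists>F_mor. cat_functor C D F_obj F_mor)"


section \<open>Matrix factorizations\<close>

type_synonym 'a mat_pair = "'a mat \<times> 'a mat"

definition matrix_factorizations :: "'a::comm_ring_1 \<Rightarrow> 'a mat_pair set" where
  "matrix_factorizations f = {(\<phi>, \<psi>). \<exists>n. \<phi> \<in> carrier_mat n n \<and> \<psi> \<in> carrier_mat n n \<and>
     \<phi> * \<psi> = f \<cdot>\<^sub>m 1\<^sub>m n \<and> \<psi> * \<phi> = f \<cdot>\<^sub>m 1\<^sub>m n}"

definition mf_size :: "'a mat_pair \<Rightarrow> nat" where
  "mf_size X = dim_row (fst X)"

definition mf_hom :: "'a::comm_ring_1 mat_pair \<Rightarrow> 'a mat_pair \<Rightarrow> 'a mat_pair set" where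
  "mf_hom = (\<lambda>(\<phi>\<^sub>1, \<psi>\<^sub>1) (\<phi>\<^sub>2, \<psi>\<^sub>2). {(\<alpha>, \<beta>).
     \<alpha> \<in> carrier_mat (mf_size (\<phi>\<^sub>2, \<psi>\<^sub>2)) (mf_size (\<phi>\<^sub>1, \<psi>\<^sub>1)) \<and>
     \<beta> \<in> carrier_mat (mf_size (\<phi>\<^sub>2, \<psi>\<^sub>2)) (mf_size (\<phi>\<^sub>1, \<psi>\<^sub>1)) \<and>
     \<alpha> * \<phi>\<^sub>1 = \<phi>\<^sub>2 * \<beta> \<and> \<psi>\<^sub>2 * \<alpha> = \<beta> * \<psi>\<^sub>1})"

definition MF :: "'a::comm_ring_1 \<Rightarrow> ('a mat_pair, 'a mat_pair) cat" where
  "MF f = \<lparr>Obj = matrix_factorizations f,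
           Hom = mf_hom,
           Ident = (\<lambda>X. (1\<^sub>m (mf_size X), 1\<^sub>m (mf_size X))),
           Comp = (\<lambda>(\<alpha>', \<beta>') (\<alpha>, \<beta>). (\<alpha>' * \<alpha>, \<beta>' * \<beta>))\<rparr>"


section \<open>The variants of the tensor product\<close>

definition kronecker :: "'a::times mat \<Rightarrow> 'a mat \<Rightarrow> 'a mat" (infixl \<open>\<otimes>\<^sub>k\<close> 72) where
  "A \<otimes>\<^sub>k B = mat (dim_row A * dim_row B) (dim_col A * dim_col B)
     (\<lambda>(i, j). A $$ (i div dim_row B, j div dim_col B) * B $$ (i mod dim_row B, j mod dim_col B))"

abbreviation in_x :: "('r, 'k::zero) mps mat \<Rightarrow> ('r + 's, 'k) mps mat" where
  "in_x \<equiv> map_mat (mps_embed Inl)"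

abbreviation in_y :: "('s, 'k::zero) mps mat \<Rightarrow> ('r + 's, 'k) mps mat" where
  "in_y \<equiv> map_mat (mps_embed Inr)"

definition tensor_variant1 ::
  "('r::finite, 'k::field) mps mat_pair \<Rightarrow> ('s::finite, 'k) mps mat_pair \<Rightarrow>
   ('r + 's, 'k) mps mat_pair" where
  "tensor_variant1 X X' =
    (let n = mf_size X; m = mf_size X';
         \<phi> = in_x (fst X); \<psi> = in_x (snd X); \<phi>' = in_y (fst X'); \<psi>' = in_y (snd X')
     in (four_block_mat (1\<^sub>m n \<otimes>\<^sub>k \<phi>') (\<psi> \<otimes>\<^sub>k 1\<^sub>m m)
                        (\<phi> \<otimes>\<^sub>k 1\<^sub>m m)  (- 1\<^sub>m n \<otimes>\<^sub>k \<psi>'),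
         four_block_mat (1\<^sub>m n \<otimes>\<^sub>k \<psi>') (\<psi> \<otimes>\<^sub>k 1\<^sub>m m)
                        (\<phi> \<otimes>\<^sub>k 1\<^sub>m m)  (- 1\<^sub>m n \<otimes>\<^sub>k \<phi>')))"

definition tensor_variant2 ::
  "('r::finite, 'k::field) mps mat_pair \<Rightarrow> ('s::finite, 'k) mps mat_pair \<Rightarrow>
   ('r + 's, 'k) mps mat_pair" where
  "tensor_variant2 X X' =
    (let n = mf_size X; m = mf_size X';
         \<phi> = in_x (fst X); \<psi> = in_x (snd X); \<phi>' = in_y (fst X'); \<psi>' = in_y (snd X')
     in (four_block_mat (\<psi> \<otimes>\<^sub>k 1\<^sub>m m)  (- 1\<^sub>m n \<otimes>\<^sub>k \<psi>')
                        (1\<^sub>m n \<otimes>\<^sub>k \<phi>') (\<phi> \<otimes>\<^sub>k 1\<^sub>m m),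
         four_block_mat (\<phi> \<otimes>\<^sub>k 1\<^sub>m m)    (1\<^sub>m n \<otimes>\<^sub>k \<psi>')
                        (- 1\<^sub>m n \<otimes>\<^sub>k \<phi>') (\<psi> \<otimes>\<^sub>k 1\<^sub>m m)))"

definition tensor_variant3 ::
  "('r::finite, 'k::field) mps mat_pair \<Rightarrow> ('s::finite, 'k) mps mat_pair \<Rightarrow>
   ('r + 's, 'k) mps mat_pair" where
  "tensor_variant3 X X' =
    (let n = mf_size X; m = mf_size X';
         \<phi> = in_x (fst X); \<psi> = in_x (snd X); \<phi>' = in_y (fst X'); \<psi>' = in_y (snd X')
     in (four_block_mat (- 1\<^sub>m n \<otimes>\<^sub>k \<psi>') (\<phi> \<otimes>\<^sub>k 1\<^sub>m m)
                        (\<psi> \<otimes>\<^sub>k 1\<^sub>m m)    (1\<^sub>m n \<otimes>\<^sub>k \<phi>'),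
         four_block_mat (- 1\<^sub>m n \<otimes>\<^sub>k \<phi>') (\<phi> \<otimes>\<^sub>k 1\<^sub>m m)
                        (\<psi> \<otimes>\<^sub>k 1\<^sub>m m)    (1\<^sub>m n \<otimes>\<^sub>k \<psi>')))"

end

theory Submission
  imports Defs
begin

text \<open>
  Put \<open>a = \<phi> \<otimes> 1\<close>, \<open>b = \<psi> \<otimes> 1\<close>, \<open>c = 1 \<otimes> \<phi>'\<close>, \<open>d = 1 \<otimes> \<psi>'\<close>. By the mixed product rule
  (\<open>kronecker_mult\<close>), \<open>a\<close> and \<open>b\<close> commute with \<open>c\<close> and \<open>d\<close>, while \<open>a b = b a = f\<close> and
  \<open>c d = d c = g\<close>. Hence in the product of the two block matrices of \<open>koszul_pair a b c d\<close>, which is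
  the first variant, the off-diagonal blocks cancel and the diagonal blocks are \<open>f + g\<close>
  (\<open>koszul_pair_in_Obj\<close>).

  The first variant is functorial in each argument through block diagonal matrices. A morphism
  \<open>(\<alpha>, \<beta>)\<close> in the second argument goes to \<open>(diag(\<alpha>, \<beta>), diag(\<beta>, \<alpha>))\<close> and a morphism in the first
  argument to \<open>(diag(\<beta>, \<alpha>), diag(\<beta>, \<alpha>))\<close>, the entries being tensored with an identity matrix. The
  intertwining conditions, read block by block, are either the two equations that define a morphism
  of factorizations or instances of the commutation above (\<open>koszul_pair_Hom\<close>). Identities and
  composition are respected because \<open>A \<mapsto> A \<otimes> 1\<close> and \<open>A \<mapsto> 1 \<otimes> A\<close> preserve identities and products
  (\<open>defines_functor_block_diag\<close>).

  The other two variants need no new computation with blocks of morphisms. Let \<open>J\<close> be the involution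
  that exchanges the two blocks, and let \<open>(\<Phi>, \<Psi>)\<close> stand for a value of the first variant. The third
  variant is \<open>(J \<Phi> J, J \<Psi> J)\<close>. The second variant is \<open>(J \<Phi>, \<Psi> J)\<close>, where \<open>(\<Phi>, \<Psi>)\<close> is now the first
  variant of \<open>(\<psi>, \<phi>)\<close> and \<open>X'\<close>, and \<open>(\<phi>, \<psi>) \<mapsto> (\<psi>, \<phi>)\<close> is itself a functor. So their values are
  isomorphic, object by object, to the values of a functor, and an assignment on objects with this
  property is the object part of a functor: conjugate the morphisms by the chosen isomorphisms
  (\<open>defines_functor_isomorphic\<close>).
\<close>


section \<open>Functors\<close>

lemma cat_functor_imp_defines_functor: "cat_functor C D F M \<Longrightarrow> defines_functor C D F"
  by (auto simp: defines_functor_def)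

lemma defines_functor_compose:
  assumes "defines_functor C D F" and "defines_functor D E G"
  shows "defines_functor C E (\<lambda>X. G (F X))"
proof -
  obtain M N where "cat_functor C D F M" and "cat_functor D E G N"
    using assms by (auto simp: defines_functor_def)
  then interpret F: cat_functor C D F M + G: cat_functor D E G N
    by auto
  have "cat_functor C E (\<lambda>X. G (F X)) (\<lambda>X Y u. N (F X) (F Y) (M X Y u))"
  proof unfold_locales
    fix X Y Z u v
    assume "X \<in> Obj C" "Y \<in> Obj C" "Z \<in> Obj C" "u \<in> Hom C X Y" "v \<in> Hom C Y Z"
    then show "N (F X) (F Z) (M X Z (Comp C v u)) =
        Comp E (N (F Y) (F Z) (M Y Z v)) (N (F X) (F Y) (M X Y u))"
      by (simp add: F.F_mor_Comp G.F_mor_Comp F.F_obj_in_Obj F.F_mor_in_Hom)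
  qed (simp_all add: F.F_obj_in_Obj G.F_obj_in_Obj F.F_mor_in_Hom G.F_mor_in_Hom
      F.F_mor_ident G.F_mor_ident)
  then show ?thesis
    by (rule cat_functor_imp_defines_functor)
qed

text \<open>
  Transport of structure: the morphism part of \<open>G\<close> is \<open>u \<mapsto> \<eta> \<circ> F u \<circ> \<theta>\<close>, and the inner factor \<open>\<theta> \<circ> \<eta>\<close>
  cancels in a composition. With this choice the given isomorphisms become natural.
\<close>

lemma defines_functor_isomorphic:
  assumes "defines_functor C D F"
    and Obj: "\<And>X. X \<in> Obj C \<Longrightarrow> G X \<in> Obj D"
    and \<eta>: "\<And>X. X \<in> Obj C \<Longrightarrow> \<eta> X \<in> Hom D (F X) (G X)"
    and \<theta>: "\<And>X. X \<in> Obj C \<Longrightarrow> \<theta> X \<in> Hom D (G X) (F X)"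
    and inv_left: "\<And>X. X \<in> Obj C \<Longrightarrow> Comp D (\<theta> X) (\<eta> X) = Ident D (F X)"
    and inv_right: "\<And>X. X \<in> Obj C \<Longrightarrow> Comp D (\<eta> X) (\<theta> X) = Ident D (G X)"
  shows "defines_functor C D G"
proof -
  obtain M where "cat_functor C D F M"
    using assms(1) by (auto simp: defines_functor_def)
  then interpret F: cat_functor C D F M .
  define N where "N = (\<lambda>X Y u. Comp D (\<eta> Y) (Comp D (M X Y u) (\<theta> X)))"
  note [simp] = F.F_obj_in_Obj Obj \<eta> \<theta>
  have inner: "Comp D (M X Y u) (\<theta> X) \<in> Hom D (G X) (F Y)"
    if "X \<in> Obj C" "Y \<in> Obj C" "u \<in> Hom C X Y" for X Y u
    using that by (intro F.cod.Comp_in_Hom[of "G X" "F X" "F Y"]) (simp_all add: F.F_mor_in_Hom)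
  have "cat_functor C D G N"
  proof unfold_locales
    fix X Y u assume "X \<in> Obj C" "Y \<in> Obj C" "u \<in> Hom C X Y"
    then show "N X Y u \<in> Hom D (G X) (G Y)"
      unfolding N_def by (intro F.cod.Comp_in_Hom[of "G X" "F Y" "G Y"]) (simp_all add: inner)
  next
    fix X assume X: "X \<in> Obj C"
    then have "Comp D (Ident D (F X)) (\<theta> X) = \<theta> X"
      by (intro F.cod.Comp_ident_left[of "G X"]) simp_all
    with X show "N X X (Ident C X) = Ident D (G X)"
      unfolding N_def by (simp add: F.F_mor_ident inv_right)
  next
    fix X Y Z u v
    assume X: "X \<in> Obj C" and Y: "Y \<in> Obj C" and Z: "Z \<in> Obj C"
      and u: "u \<in> Hom C X Y" and v: "v \<in> Hom C Y Z"
    let ?u = "Comp D (M X Y u) (\<theta> X)"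
    have Mv: "M Y Z v \<in> Hom D (F Y) (F Z)" and Mu: "M X Y u \<in> Hom D (F X) (F Y)"
      using X Y Z u v by (simp_all add: F.F_mor_in_Hom)
    have u': "?u \<in> Hom D (G X) (F Y)"
      using X Y u by (rule inner)
    have tu: "Comp D (\<eta> Y) ?u \<in> Hom D (G X) (G Y)"
      by (rule F.cod.Comp_in_Hom[of _ "F Y"]) (use X Y u' in simp_all)
    have cancel: "Comp D (\<theta> Y) (Comp D (\<eta> Y) ?u) = ?u"
    proof -
      have "Comp D (\<theta> Y) (Comp D (\<eta> Y) ?u) = Comp D (Comp D (\<theta> Y) (\<eta> Y)) ?u"
        by (rule F.cod.Comp_assoc[of "G X" "F Y" "G Y" "F Y"]) (use X Y u' in simp_all)
      also have "\<dots> = ?u"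
        unfolding inv_left[OF Y] by (rule F.cod.Comp_ident_left[of "G X"]) (use X Y u' in simp_all)
      finally show ?thesis .
    qed
    have "Comp D (N Y Z v) (N X Y u) =
        Comp D (\<eta> Z) (Comp D (Comp D (M Y Z v) (\<theta> Y)) (Comp D (\<eta> Y) ?u))"
      unfolding N_def
      by (rule F.cod.Comp_assoc[of "G X" "G Y" "F Z" "G Z", symmetric])
        (use X Y Z v tu in \<open>simp_all add: inner\<close>)
    also have "Comp D (Comp D (M Y Z v) (\<theta> Y)) (Comp D (\<eta> Y) ?u) =
        Comp D (M Y Z v) (Comp D (\<theta> Y) (Comp D (\<eta> Y) ?u))"
      by (rule F.cod.Comp_assoc[of "G X" "G Y" "F Y" "F Z", symmetric])
        (use X Y Z Mv tu in simp_all)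
    also have "\<dots> = Comp D (M Y Z v) ?u"
      by (simp only: cancel)
    also have "\<dots> = Comp D (Comp D (M Y Z v) (M X Y u)) (\<theta> X)"
      by (rule F.cod.Comp_assoc[of "G X" "F X" "F Y" "F Z"]) (use X Y Z Mu Mv in simp_all)
    also have "Comp D (M Y Z v) (M X Y u) = M X Z (Comp C v u)"
      using X Y Z u v by (simp add: F.F_mor_Comp)
    finally show "N X Z (Comp C v u) = Comp D (N Y Z v) (N X Y u)"
      by (simp add: N_def)
  qed simp
  then show ?thesis
    by (rule cat_functor_imp_defines_functor)
qed


section \<open>The category of matrix factorizations\<close>

lemma Obj_MF_iff:
  "(\<phi>, \<psi>) \<in> Obj (MF f) \<longleftrightarrow> (\<exists>n. \<phi> \<in> carrier_mat n n \<and> \<psi> \<in> carrier_mat n n \<and>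
     \<phi> * \<psi> = f \<cdot>\<^sub>m 1\<^sub>m n \<and> \<psi> * \<phi> = f \<cdot>\<^sub>m 1\<^sub>m n)"
  by (simp add: MF_def matrix_factorizations_def)

lemma Obj_MF_cases:
  assumes "X \<in> Obj (MF f)"
  obtains n \<phi> \<psi> where "X = (\<phi>, \<psi>)" "\<phi> \<in> carrier_mat n n" "\<psi> \<in> carrier_mat n n"
    "\<phi> * \<psi> = f \<cdot>\<^sub>m 1\<^sub>m n" "\<psi> * \<phi> = f \<cdot>\<^sub>m 1\<^sub>m n"
  using assms by (cases X) (auto simp: Obj_MF_iff)

lemma Hom_MF_iff:
  assumes "\<phi>\<^sub>1 \<in> carrier_mat n n" and "\<phi>\<^sub>2 \<in> carrier_mat m m"
  shows "(\<alpha>, \<beta>) \<in> Hom (MF f) (\<phi>\<^sub>1, \<psi>\<^sub>1) (\<phi>\<^sub>2, \<psi>\<^sub>2) \<longleftrightarrow>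
    \<alpha> \<in> carrier_mat m n \<and> \<beta> \<in> carrier_mat m n \<and> \<alpha> * \<phi>\<^sub>1 = \<phi>\<^sub>2 * \<beta> \<and> \<psi>\<^sub>2 * \<alpha> = \<beta> * \<psi>\<^sub>1"
  using assms by (simp add: MF_def mf_hom_def mf_size_def)

lemma Hom_MF_carrier:
  assumes "u \<in> Hom (MF f) X Y"
  shows "fst u \<in> carrier_mat (mf_size Y) (mf_size X)"
    and "snd u \<in> carrier_mat (mf_size Y) (mf_size X)"
  using assms by (auto simp: MF_def mf_hom_def split: prod.splits)

lemma Comp_MF [simp]: "Comp (MF f) (\<alpha>', \<beta>') (\<alpha>, \<beta>) = (\<alpha>' * \<alpha>, \<beta>' * \<beta>)"
  by (simp add: MF_def)

lemma Comp_MF_eq: "Comp (MF f) v u = (fst v * fst u, snd v * snd u)"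
  by (simp add: MF_def case_prod_unfold)

lemma Ident_MF: "Ident (MF f) X = (1\<^sub>m (mf_size X), 1\<^sub>m (mf_size X))"
  by (simp add: MF_def)

lemma mf_size_eq: "\<phi> \<in> carrier_mat n n \<Longrightarrow> mf_size (\<phi>, \<psi>) = n"
  by (simp add: mf_size_def)

lemma category_MF: "category (MF f)"
proof
  fix X assume "X \<in> Obj (MF f)"
  then show "Ident (MF f) X \<in> Hom (MF f) X X"
    by (elim Obj_MF_cases) (simp add: Hom_MF_iff Ident_MF mf_size_eq)
next
  fix X Y Z u v
  assume X: "X \<in> Obj (MF f)" and Y: "Y \<in> Obj (MF f)" and Z: "Z \<in> Obj (MF f)"
    and uv: "u \<in> Hom (MF f) X Y" "v \<in> Hom (MF f) Y Z"
  from X obtain n \<phi>\<^sub>1 \<psi>\<^sub>1 where X_eq: "X = (\<phi>\<^sub>1, \<psi>\<^sub>1)"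
    and [simp]: "\<phi>\<^sub>1 \<in> carrier_mat n n" "\<psi>\<^sub>1 \<in> carrier_mat n n"
    by (rule Obj_MF_cases)
  from Y obtain m \<phi>\<^sub>2 \<psi>\<^sub>2 where Y_eq: "Y = (\<phi>\<^sub>2, \<psi>\<^sub>2)"
    and [simp]: "\<phi>\<^sub>2 \<in> carrier_mat m m" "\<psi>\<^sub>2 \<in> carrier_mat m m"
    by (rule Obj_MF_cases)
  from Z obtain k \<phi>\<^sub>3 \<psi>\<^sub>3 where Z_eq: "Z = (\<phi>\<^sub>3, \<psi>\<^sub>3)"
    and [simp]: "\<phi>\<^sub>3 \<in> carrier_mat k k" "\<psi>\<^sub>3 \<in> carrier_mat k k"
    by (rule Obj_MF_cases)
  note XYZ = X_eq Y_eq Z_eq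
  obtain \<alpha> \<beta> \<alpha>' \<beta>' where u: "u = (\<alpha>, \<beta>)" and v: "v = (\<alpha>', \<beta>')"
    by (cases u, cases v)
  from uv have [simp]: "\<alpha> \<in> carrier_mat m n" "\<beta> \<in> carrier_mat m n"
      "\<alpha>' \<in> carrier_mat k m" "\<beta>' \<in> carrier_mat k m"
    and eqs: "\<alpha> * \<phi>\<^sub>1 = \<phi>\<^sub>2 * \<beta>" "\<psi>\<^sub>2 * \<alpha> = \<beta> * \<psi>\<^sub>1" "\<alpha>' * \<phi>\<^sub>2 = \<phi>\<^sub>3 * \<beta>'" "\<psi>\<^sub>3 * \<alpha>' = \<beta>' * \<psi>\<^sub>2"
    by (simp_all add: Hom_MF_iff[of _ n _ m] Hom_MF_iff[of _ m _ k] XYZ u v)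
  have "\<alpha>' * \<alpha> * \<phi>\<^sub>1 = \<phi>\<^sub>3 * (\<beta>' * \<beta>)"
  proof -
    have "\<alpha>' * \<alpha> * \<phi>\<^sub>1 = \<alpha>' * (\<alpha> * \<phi>\<^sub>1)"
      by (rule assoc_mult_mat[of _ k m _ n _ n]) simp_all
    also have "\<dots> = \<alpha>' * \<phi>\<^sub>2 * \<beta>"
      unfolding eqs(1) by (rule assoc_mult_mat[of _ k m _ m _ n, symmetric]) simp_all
    also have "\<dots> = \<phi>\<^sub>3 * (\<beta>' * \<beta>)"
      unfolding eqs(3) by (rule assoc_mult_mat[of _ k k _ m _ n]) simp_all
    finally show ?thesis .
  qed
  moreover have "\<psi>\<^sub>3 * (\<alpha>' * \<alpha>) = \<beta>' * \<beta> * \<psi>\<^sub>1"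
  proof -
    have "\<psi>\<^sub>3 * (\<alpha>' * \<alpha>) = \<psi>\<^sub>3 * \<alpha>' * \<alpha>"
      by (rule assoc_mult_mat[of _ k k _ m _ n, symmetric]) simp_all
    also have "\<dots> = \<beta>' * (\<psi>\<^sub>2 * \<alpha>)"
      unfolding eqs(4) by (rule assoc_mult_mat[of _ k m _ m _ n]) simp_all
    also have "\<dots> = \<beta>' * \<beta> * \<psi>\<^sub>1"
      unfolding eqs(2) by (rule assoc_mult_mat[of _ k m _ n _ n, symmetric]) simp_all
    finally show ?thesis .
  qed
  ultimately show "Comp (MF f) v u \<in> Hom (MF f) X Z"
    by (simp add: Hom_MF_iff[of _ n _ k] XYZ u v mult_carrier_mat[of _ k m])
next
  fix X Y u assume "u \<in> Hom (MF f) X Y"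
  note carrier = Hom_MF_carrier[OF this]
  show "Comp (MF f) u (Ident (MF f) X) = u"
    using carrier by (cases u) (simp add: Ident_MF)
  show "Comp (MF f) (Ident (MF f) Y) u = u"
    using carrier by (cases u) (simp add: Ident_MF)
next
  fix W X Y Z u v w
  assume uvw: "u \<in> Hom (MF f) W X" "v \<in> Hom (MF f) X Y" "w \<in> Hom (MF f) Y Z"
  note carrier = uvw[THEN Hom_MF_carrier(1)] uvw[THEN Hom_MF_carrier(2)]
  show "Comp (MF f) w (Comp (MF f) v u) = Comp (MF f) (Comp (MF f) w v) u"
    using carrier
    by (cases u; cases v; cases w)
      (simp add: assoc_mult_mat[of _ "mf_size Z" "mf_size Y" _ "mf_size X" _ "mf_size W"])
qed

text \<open>
  Exchanging the two matrices of every factorization and the two matrices of every morphism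
  exchanges the two equations \<open>\<alpha> \<phi>\<^sub>1 = \<phi>\<^sub>2 \<beta>\<close> and \<open>\<psi>\<^sub>2 \<alpha> = \<beta> \<psi>\<^sub>1\<close> (each read from right to left).
\<close>

lemma defines_functor_swap: "defines_functor (MF f) (MF f) (\<lambda>X. (snd X, fst X))"
proof (rule cat_functor_imp_defines_functor)
  interpret category "MF f"
    by (rule category_MF)
  show "cat_functor (MF f) (MF f) (\<lambda>X. (snd X, fst X)) (\<lambda>X Y u. (snd u, fst u))"
  proof unfold_locales
    fix X assume "X \<in> Obj (MF f)"
    then show "(snd X, fst X) \<in> Obj (MF f)"
      by (elim Obj_MF_cases) (auto simp: Obj_MF_iff)
  next
    fix X Y u assume "X \<in> Obj (MF f)" "Y \<in> Obj (MF f)" "u \<in> Hom (MF f) X Y"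
    then show "(snd u, fst u) \<in> Hom (MF f) (snd X, fst X) (snd Y, fst Y)"
      by (cases u; elim Obj_MF_cases; simp add: Hom_MF_iff)
  next
    fix X assume "X \<in> Obj (MF f)"
    then show "(snd (Ident (MF f) X), fst (Ident (MF f) X)) = Ident (MF f) (snd X, fst X)"
      by (elim Obj_MF_cases) (simp add: Ident_MF mf_size_eq)
  qed (simp add: MF_def case_prod_unfold)
qed


section \<open>Block matrices\<close>

text \<open>The blocks need not be square: morphisms between factorizations of different sizes occur.\<close>

definition block_diag :: "'a::zero mat \<Rightarrow> 'a mat \<Rightarrow> 'a mat" where
  "block_diag A D =
     four_block_mat A (0\<^sub>m (dim_row A) (dim_col D)) (0\<^sub>m (dim_row D) (dim_col A)) D"

lemma block_diag_carrier:
  "\<lbrakk>A \<in> carrier_mat nr1 nc1; D \<in> carrier_mat nr2 nc2\<rbrakk>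
    \<Longrightarrow> block_diag A D \<in> carrier_mat (nr1 + nr2) (nc1 + nc2)"
  by (simp add: block_diag_def)

lemma block_diag_one: "block_diag (1\<^sub>m n) (1\<^sub>m m) = 1\<^sub>m (n + m)"
  by (simp add: block_diag_def)

lemma block_diag_smult_one:
  "block_diag (c \<cdot>\<^sub>m 1\<^sub>m n) (c \<cdot>\<^sub>m 1\<^sub>m m) = c \<cdot>\<^sub>m (1\<^sub>m (n + m) :: 'a::semiring_1 mat)"
  by (rule eq_matI) (auto simp: block_diag_def)

lemma block_diag_mult_four_block:
  fixes U V A B C D :: "'a::semiring_1 mat"
  assumes "U \<in> carrier_mat k1 n1" "V \<in> carrier_mat k2 n2"
    and "A \<in> carrier_mat n1 m1" "B \<in> carrier_mat n1 m2" "C \<in> carrier_mat n2 m1" "D \<in> carrier_mat n2 m2"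
  shows "block_diag U V * four_block_mat A B C D = four_block_mat (U * A) (U * B) (V * C) (V * D)"
proof -
  have "dim_row U = k1" "dim_col U = n1" "dim_row V = k2" "dim_col V = n2"
    using assms by auto
  then show ?thesis
    unfolding block_diag_def using assms
    by (subst mult_four_block_mat[of _ k1 n1 _ n2 _ k2 _ _ m1 _ m2])
      (simp_all add: left_add_zero_mat[of _ k1] left_add_zero_mat[of _ k2]
        right_add_zero_mat[of _ k1] right_add_zero_mat[of _ k2]
        mult_carrier_mat[of _ k1 n1] mult_carrier_mat[of _ k2 n2])
qed

lemma four_block_mult_block_diag:
  fixes U V A B C D :: "'a::semiring_1 mat"
  assumes "A \<in> carrier_mat n1 m1" "B \<in> carrier_mat n1 m2" "C \<in> carrier_mat n2 m1" "D \<in> carrier_mat n2 m2"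
    and "U \<in> carrier_mat m1 k1" "V \<in> carrier_mat m2 k2"
  shows "four_block_mat A B C D * block_diag U V = four_block_mat (A * U) (B * V) (C * U) (D * V)"
proof -
  have "dim_row U = m1" "dim_col U = k1" "dim_row V = m2" "dim_col V = k2"
    using assms by auto
  then show ?thesis
    unfolding block_diag_def using assms
    by (subst mult_four_block_mat[of _ n1 m1 _ m2 _ n2 _ _ k1 _ k2])
      (simp_all add: left_add_zero_mat[of _ n1] left_add_zero_mat[of _ n2]
        right_add_zero_mat[of _ n1] right_add_zero_mat[of _ n2] mult_carrier_mat[of _ n1 m1]
        mult_carrier_mat[of _ n1 m2] mult_carrier_mat[of _ n2 m1] mult_carrier_mat[of _ n2 m2])
qed

lemma block_diag_mult:
  fixes A B C D :: "'a::semiring_1 mat"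
  assumes "A \<in> carrier_mat k1 n1" "D \<in> carrier_mat k2 n2"
    and "A' \<in> carrier_mat n1 m1" "D' \<in> carrier_mat n2 m2"
  shows "block_diag A D * block_diag A' D' = block_diag (A * A') (D * D')"
proof -
  have "dim_row A' = n1" "dim_col A' = m1" "dim_row D' = n2" "dim_col D' = m2"
    "dim_row A = k1" "dim_row D = k2"
    using assms by auto
  then show ?thesis
    unfolding block_diag_def[of A'] using assms
    by (subst block_diag_mult_four_block[of _ k1 n1 _ k2 n2 _ m1 _ m2])
       (simp_all add: block_diag_def)
qed

definition block_swap :: "nat \<Rightarrow> 'a::semiring_1 mat" where
  "block_swap k = four_block_mat (0\<^sub>m k k) (1\<^sub>m k) (1\<^sub>m k) (0\<^sub>m k k)"

lemma block_swap_carrier [simp]: "block_swap k \<in> carrier_mat (k + k) (k + k)"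
  by (simp add: block_swap_def)

lemma block_swap_mult_four_block:
  assumes "A \<in> carrier_mat k k" "B \<in> carrier_mat k k" "C \<in> carrier_mat k k" "D \<in> carrier_mat k k"
  shows "block_swap k * four_block_mat A B C D = four_block_mat C D A B"
  unfolding block_swap_def using assms
  by (subst mult_four_block_mat[of _ k k _ k _ k _ _ k _ k])
    (simp_all add: left_add_zero_mat[of _ k k] right_add_zero_mat[of _ k k])

lemma four_block_mult_block_swap:
  assumes "A \<in> carrier_mat k k" "B \<in> carrier_mat k k" "C \<in> carrier_mat k k" "D \<in> carrier_mat k k"
  shows "four_block_mat A B C D * block_swap k = four_block_mat B A D C"
  unfolding block_swap_def using assms
  by (subst mult_four_block_mat[of _ k k _ k _ k _ _ k _ k])
    (simp_all add: left_add_zero_mat[of _ k k] right_add_zero_mat[of _ k k])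

lemma block_swap_involution: "block_swap k * block_swap k = 1\<^sub>m (k + k)"
  by (subst (2) block_swap_def) (simp add: block_swap_mult_four_block)


section \<open>Constructing functors between categories of matrix factorizations\<close>

text \<open>
  \<open>L\<close> stands for \<open>A \<mapsto> 1 \<otimes> A\<close> or \<open>A \<mapsto> A \<otimes> 1\<close>, and \<open>s\<close> for its effect on sizes. Such an \<open>L\<close> is functorial,
  and so is the formation of block diagonal matrices; therefore any choice of \<open>\<alpha>\<close> or \<open>\<beta>\<close> for each of the
  four diagonal entries respects identities and composition, and only the object part and the
  intertwining conditions remain.
\<close>

lemma defines_functor_block_diag:
  fixes L :: "'a::comm_ring_1 mat \<Rightarrow> 'b::comm_ring_1 mat"
  assumes carrier: "\<And>A p q. A \<in> carrier_mat p q \<Longrightarrow> L A \<in> carrier_mat (s p) (s q)"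
    and mult: "\<And>A B p q r. \<lbrakk>A \<in> carrier_mat p q; B \<in> carrier_mat q r\<rbrakk> \<Longrightarrow> L (A * B) = L A * L B"
    and one: "\<And>p. L (1\<^sub>m p) = 1\<^sub>m (s p)"
    and proj: "{i, j, i', j'} \<subseteq> {fst, snd}"
    and Obj: "\<And>X. X \<in> Obj (MF g) \<Longrightarrow> F X \<in> Obj (MF h)"
    and size: "\<And>X. X \<in> Obj (MF g) \<Longrightarrow> mf_size (F X) = s (mf_size X) + s (mf_size X)"
    and Hom: "\<And>X Y u. \<lbrakk>X \<in> Obj (MF g); Y \<in> Obj (MF g); u \<in> Hom (MF g) X Y\<rbrakk> \<Longrightarrow>
      (block_diag (L (i u)) (L (j u)), block_diag (L (i' u)) (L (j' u))) \<in> Hom (MF h) (F X) (F Y)"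
  shows "defines_functor (MF g) (MF h) F"
proof (rule cat_functor_imp_defines_functor)
  interpret dom: category "MF g" by (rule category_MF)
  interpret cod: category "MF h" by (rule category_MF)
  let ?M = "\<lambda>u. (block_diag (L (i u)) (L (j u)), block_diag (L (i' u)) (L (j' u)))"
  show "cat_functor (MF g) (MF h) F (\<lambda>X Y. ?M)"
  proof unfold_locales
    fix X assume "X \<in> Obj (MF g)"
    then show "?M (Ident (MF g) X) = Ident (MF h) (F X)"
      using proj by (auto simp: Ident_MF one block_diag_one size)
  next
    fix X Y Z u v
    assume uv: "u \<in> Hom (MF g) X Y" "v \<in> Hom (MF g) Y Z"
    have comp: "block_diag (L (e (Comp (MF g) v u))) (L (e' (Comp (MF g) v u))) =
        block_diag (L (e v)) (L (e' v)) * block_diag (L (e u)) (L (e' u))"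
      if "e \<in> {fst, snd}" "e' \<in> {fst, snd}" for e e'
    proof -
      let ?p = "mf_size X" and ?q = "mf_size Y" and ?r = "mf_size Z"
      have uv_carrier: "e u \<in> carrier_mat ?q ?p" "e' u \<in> carrier_mat ?q ?p"
        "e v \<in> carrier_mat ?r ?q" "e' v \<in> carrier_mat ?r ?q"
        using that uv by (auto dest: Hom_MF_carrier)
      have "e (Comp (MF g) v u) = e v * e u" "e' (Comp (MF g) v u) = e' v * e' u"
        using that by (auto simp: Comp_MF_eq)
      then show ?thesis
        using uv_carrier by (simp add: mult[of _ ?r ?q _ ?p] carrier
          block_diag_mult[of _ "s ?r" "s ?q" _ "s ?r" "s ?q" _ "s ?p" _ "s ?p"])
    qed
    show "?M (Comp (MF g) v u) = Comp (MF h) (?M v) (?M u)"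
      using proj by (simp add: comp)
  qed (simp_all add: Obj Hom)
qed

text \<open>
  For involutions \<open>P\<close> and \<open>Q\<close> the pair \<open>(P, Q)\<close> is an isomorphism from \<open>(\<Phi>, \<Psi>)\<close> to
  \<open>(P \<Phi> Q, Q \<Psi> P)\<close>, and the same pair is its inverse.
\<close>

lemma defines_functor_equivalent:
  fixes h :: "'a::comm_ring_1"
  assumes F: "defines_functor C (MF h) F"
    and P: "\<And>X. X \<in> Obj C \<Longrightarrow> P X \<in> carrier_mat (mf_size (F X)) (mf_size (F X))"
      "\<And>X. X \<in> Obj C \<Longrightarrow> P X * P X = 1\<^sub>m (mf_size (F X))"
    and Q: "\<And>X. X \<in> Obj C \<Longrightarrow> Q X \<in> carrier_mat (mf_size (F X)) (mf_size (F X))"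
      "\<And>X. X \<in> Obj C \<Longrightarrow> Q X * Q X = 1\<^sub>m (mf_size (F X))"
    and G: "\<And>X. X \<in> Obj C \<Longrightarrow> G X = (P X * fst (F X) * Q X, Q X * snd (F X) * P X)"
  shows "defines_functor C (MF h) G"
proof (rule defines_functor_isomorphic[OF F])
  fix X assume X: "X \<in> Obj C"
  let ?P = "P X" and ?Q = "Q X"
  have "F X \<in> Obj (MF h)"
    using F X by (auto simp: defines_functor_def cat_functor_def cat_functor_axioms_def)
  then obtain n \<Phi> \<Psi> where FX: "F X = (\<Phi>, \<Psi>)"
    and [simp]: "\<Phi> \<in> carrier_mat n n" "\<Psi> \<in> carrier_mat n n"
    and fact: "\<Phi> * \<Psi> = h \<cdot>\<^sub>m 1\<^sub>m n" "\<Psi> * \<Phi> = h \<cdot>\<^sub>m 1\<^sub>m n"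
    by (rule Obj_MF_cases)
  have [simp]: "?P \<in> carrier_mat n n" "?Q \<in> carrier_mat n n"
    and involution: "?P * ?P = 1\<^sub>m n" "?Q * ?Q = 1\<^sub>m n"
    using P[OF X] Q[OF X] by (simp_all add: FX mf_size_eq[of _ n])
  note closed [simp] = mult_carrier_mat[of _ n n _ n]
  note assoc = assoc_mult_mat[of _ n n _ n _ n]
  have cancel: "?P * (?P * A) = A" "?Q * (?Q * A) = A" if "A \<in> carrier_mat n n" for A
    using that by (simp_all add: assoc[symmetric] involution)
  have conjugate: "R * A * S * (S * B * R) = h \<cdot>\<^sub>m 1\<^sub>m n"
    if [simp]: "R \<in> carrier_mat n n" "S \<in> carrier_mat n n" "A \<in> carrier_mat n n" "B \<in> carrier_mat n n"
      and "R * R = 1\<^sub>m n" "S * S = 1\<^sub>m n" "A * B = h \<cdot>\<^sub>m 1\<^sub>m n" for R S A B :: "'a mat"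
  proof -
    have "R * A * S * (S * B * R) = R * (A * (S * S * (B * R)))"
      by (simp add: assoc)
    also have "\<dots> = R * (A * B * R)"
      using \<open>S * S = 1\<^sub>m n\<close> by (simp add: assoc left_mult_one_mat[of _ n n])
    also have "\<dots> = h \<cdot>\<^sub>m 1\<^sub>m n"
      using that by (simp add: mult_smult_distrib[of _ n n _ n] mult_smult_assoc_mat[of _ n n _ n]
          left_mult_one_mat[of _ n n])
    finally show ?thesis .
  qed
  have GX: "G X = (?P * \<Phi> * ?Q, ?Q * \<Psi> * ?P)"
    by (simp add: G[OF X] FX)
  show "G X \<in> Obj (MF h)"
    unfolding GX Obj_MF_iff
    using conjugate[of ?P ?Q \<Phi> \<Psi>] conjugate[of ?Q ?P \<Psi> \<Phi>] fact involution
    by (intro exI[of _ n]) simp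
  show "(?P, ?Q) \<in> Hom (MF h) (F X) (G X)" "(?P, ?Q) \<in> Hom (MF h) (G X) (F X)"
    by (simp_all add: FX GX Hom_MF_iff[of _ n _ n] assoc cancel involution right_mult_one_mat[of _ n n])
  show "Comp (MF h) (?P, ?Q) (?P, ?Q) = Ident (MF h) (F X)"
    and "Comp (MF h) (?P, ?Q) (?P, ?Q) = Ident (MF h) (G X)"
    by (simp_all add: FX GX Ident_MF mf_size_eq[of _ n] involution)
qed


section \<open>The Koszul-type block factorization\<close>

text \<open>
  The tensor product of two 2-periodic sequences of maps, one alternating between \<open>a\<close> and \<open>b\<close> and one
  between \<open>c\<close> and \<open>d\<close>, folded into one such sequence as for a Koszul complex; the minus sign is the
  Koszul sign.
\<close>

definition koszul_pair :: "'a::comm_ring_1 mat \<Rightarrow> 'a mat \<Rightarrow> 'a mat \<Rightarrow> 'a mat \<Rightarrow> 'a mat_pair" where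
  "koszul_pair a b c d = (four_block_mat c b a (- d), four_block_mat d b a (- c))"

lemma koszul_pair_in_Obj:
  fixes a b c d :: "'a::comm_ring_1 mat"
  assumes [simp]: "a \<in> carrier_mat k k" "b \<in> carrier_mat k k"
      "c \<in> carrier_mat k k" "d \<in> carrier_mat k k"
    and ab: "a * b = p \<cdot>\<^sub>m 1\<^sub>m k" "b * a = p \<cdot>\<^sub>m 1\<^sub>m k"
    and cd: "c * d = q \<cdot>\<^sub>m 1\<^sub>m k" "d * c = q \<cdot>\<^sub>m 1\<^sub>m k"
    and comm: "a * c = c * a" "a * d = d * a" "b * c = c * b" "b * d = d * b"
  shows "koszul_pair a b c d \<in> Obj (MF (p + q))"
proof -
  have cancel: "x + - x = 0\<^sub>m k k" if "x \<in> carrier_mat k k" for x :: "'a mat"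
    using that by (intro eq_matI) auto
  \<comment> \<open>The second product arises from the first by exchanging \<open>c\<close> and \<open>d\<close>.\<close>
  have product: "four_block_mat c b a (- d) * four_block_mat d b a (- c) = (p + q) \<cdot>\<^sub>m 1\<^sub>m (k + k)"
    if [simp]: "c \<in> carrier_mat k k" "d \<in> carrier_mat k k"
      and cd: "c * d = q \<cdot>\<^sub>m 1\<^sub>m k" "d * c = q \<cdot>\<^sub>m 1\<^sub>m k"
      and comm: "a * d = d * a" "b * c = c * b"
    for c d :: "'a mat"
  proof -
    have "four_block_mat c b a (- d) * four_block_mat d b a (- c) =
        four_block_mat (c * d + b * a) (c * b + b * - c) (a * d + - d * a) (a * b + - d * - c)"
      by (rule mult_four_block_mat[of _ k k _ k _ k _ _ k _ k]) simp_all
    also have "c * d + b * a = (p + q) \<cdot>\<^sub>m 1\<^sub>m k"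
      unfolding ab cd by (rule eq_matI) (auto simp: algebra_simps)
    also have "c * b + b * - c = 0\<^sub>m k k"
      by (simp add: comm cancel carrier_matD[of _ k k] mult_carrier_mat[of _ k k])
    also have "a * d + - d * a = 0\<^sub>m k k"
      by (simp add: comm cancel carrier_matD[of _ k k] mult_carrier_mat[of _ k k])
    also have "- d * - c = d * c"
      by (simp add: carrier_matD[of _ k k])
    also have "a * b + d * c = (p + q) \<cdot>\<^sub>m 1\<^sub>m k"
      unfolding ab cd by (rule eq_matI) (auto simp: algebra_simps)
    also have "four_block_mat ((p + q) \<cdot>\<^sub>m 1\<^sub>m k) (0\<^sub>m k k) (0\<^sub>m k k) ((p + q) \<cdot>\<^sub>m 1\<^sub>m k) =
        (p + q) \<cdot>\<^sub>m 1\<^sub>m (k + k)"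
      using block_diag_smult_one[of "p + q" k k] by (simp add: block_diag_def)
    finally show ?thesis .
  qed
  show ?thesis
    unfolding koszul_pair_def Obj_MF_iff
    using product[of c d] product[of d c] cd comm by (intro exI[of _ "k + k"]) simp
qed

text \<open>
  Up to signs, the eight equations are the blocks of the two intertwining conditions. For a morphism
  in one tensor factor, four of them express that it is a morphism and four that it commutes with
  the matrices of the other factor.
\<close>

lemma koszul_pair_Hom:
  fixes a b c d :: "'a::comm_ring_1 mat"
  assumes [simp]: "a \<in> carrier_mat k k" "b \<in> carrier_mat k k"
      "c \<in> carrier_mat k k" "d \<in> carrier_mat k k"
      "a' \<in> carrier_mat l l" "b' \<in> carrier_mat l l"
      "c' \<in> carrier_mat l l" "d' \<in> carrier_mat l l"
      "u \<in> carrier_mat l k" "v \<in> carrier_mat l k" "u' \<in> carrier_mat l k" "v' \<in> carrier_mat l k"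
    and eqs: "u * c = c' * u'" "u * b = b' * v'" "v * a = a' * u'" "v * d = d' * v'"
      "d' * u = u' * d" "b' * v = u' * b" "a' * u = v' * a" "c' * v = v' * c"
  shows "(block_diag u v, block_diag u' v') \<in>
    Hom (MF h) (koszul_pair a b c d) (koszul_pair a' b' c' d')"
proof -
  have dims: "dim_col u = k" "dim_col v = k" "dim_col u' = k" "dim_col v' = k"
    "dim_row c = k" "dim_row d = k" "dim_col c' = l" "dim_col d' = l"
    "dim_row u = l" "dim_row v = l" "dim_row u' = l" "dim_row v' = l"
    using assms(1-12) unfolding carrier_mat_def by simp_all
  have "block_diag u v * four_block_mat c b a (- d) =
      four_block_mat c' b' a' (- d') * block_diag u' v'"
    by (subst block_diag_mult_four_block[of _ l k _ l k _ k _ k], simp_all,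
        subst four_block_mult_block_diag[of _ l l _ l _ l _ _ k _ k])
      (simp_all add: eqs dims)
  moreover have "four_block_mat d' b' a' (- c') * block_diag u v =
      block_diag u' v' * four_block_mat d b a (- c)"
    by (subst block_diag_mult_four_block[of _ l k _ l k _ k _ k], simp_all,
        subst four_block_mult_block_diag[of _ l l _ l _ l _ _ k _ k])
      (simp_all add: eqs dims)
  ultimately show ?thesis
    by (simp add: koszul_pair_def Hom_MF_iff[of _ "k + k" _ "l + l"] block_diag_carrier)
qed


section \<open>Enlarging the set of variables\<close>

lemma mps_coeff_embed:
  "mps_coeff (mps_embed \<iota> p) m = (if \<forall>j. j \<notin> range \<iota> \<longrightarrow> m j = 0 then mps_coeff p (m \<circ> \<iota>) else 0)"
  by (simp add: mps_embed.rep_eq)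

text \<open>
  If \<open>m\<close> involves only variables in the range of \<open>\<iota>\<close>, then so do both parts of every splitting of \<open>m\<close>,
  and restriction along \<open>\<iota>\<close> is a bijection onto the splittings of \<open>m \<circ> \<iota>\<close>, with extension by zero as its
  inverse. Otherwise one part of every splitting involves a new variable, and all terms vanish.
\<close>

lemma mps_embed_mult:
  fixes \<iota> :: "'v::finite \<Rightarrow> 'w::finite" and p q :: "('v, 'k::comm_ring_1) mps"
  assumes "inj \<iota>"
  shows "mps_embed \<iota> (p * q) = mps_embed \<iota> p * mps_embed \<iota> q"
proof (rule mps_eqI)
  fix m :: "'w \<Rightarrow> nat"
  let ?supported = "\<lambda>m :: 'w \<Rightarrow> nat. \<forall>j. j \<notin> range \<iota> \<longrightarrow> m j = 0"
  show "mps_coeff (mps_embed \<iota> (p * q)) m = mps_coeff (mps_embed \<iota> p * mps_embed \<iota> q) m"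
  proof (cases "?supported m")
    case True
    define extend where "extend = (\<lambda>(a :: 'v \<Rightarrow> nat) j. if j \<in> range \<iota> then a (inv_into UNIV \<iota> j) else 0)"
    have extend_restrict: "extend (a \<circ> \<iota>) = a" if "?supported a" for a
      using that assms by (auto simp: extend_def fun_eq_iff)
    have restrict_extend: "extend a \<circ> \<iota> = a" for a
      using assms by (auto simp: extend_def fun_eq_iff)
    have supported_extend: "?supported (extend a)" for a
      by (simp add: extend_def)
    have extend_split: "(\<lambda>j. extend a j + extend b j) = m"
      if "(\<lambda>i. a i + b i) = m \<circ> \<iota>" for a b
    proof -
      have "(\<lambda>j. extend a j + extend b j) = extend (\<lambda>i. a i + b i)"
        by (auto simp: extend_def)
      then show ?thesis
        using True that extend_restrict by simp
    qed
    have supported_split: "?supported a \<and> ?supported b" if "(a, b) \<in> monomial_splits m" for a b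
      using that True by (auto simp: monomial_splits_def)
    have "(\<Sum>(a, b)\<in>monomial_splits (m \<circ> \<iota>). mps_coeff p a * mps_coeff q b) =
        (\<Sum>(a, b)\<in>monomial_splits m. mps_coeff (mps_embed \<iota> p) a * mps_coeff (mps_embed \<iota> q) b)"
    proof (rule sum.reindex_bij_witness[where i = "\<lambda>(a, b). (a \<circ> \<iota>, b \<circ> \<iota>)"
          and j = "\<lambda>(a, b). (extend a, extend b)"])
      fix s assume "s \<in> monomial_splits (m \<circ> \<iota>)"
      then obtain a b where s: "s = (a, b)" and ab: "(\<lambda>i. a i + b i) = m \<circ> \<iota>"
        by (auto simp: monomial_splits_def)
      show "(case case s of (a, b) \<Rightarrow> (extend a, extend b) of (a, b) \<Rightarrow> (a \<circ> \<iota>, b \<circ> \<iota>)) = s"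
        by (simp add: s restrict_extend)
      show "(case s of (a, b) \<Rightarrow> (extend a, extend b)) \<in> monomial_splits m"
        using extend_split[OF ab] by (simp add: s monomial_splits_def)
      show "(case case s of (a, b) \<Rightarrow> (extend a, extend b) of
          (a, b) \<Rightarrow> mps_coeff (mps_embed \<iota> p) a * mps_coeff (mps_embed \<iota> q) b) =
          (case s of (a, b) \<Rightarrow> mps_coeff p a * mps_coeff q b)"
        unfolding s prod.case mps_coeff_embed restrict_extend
        using supported_extend[of a] supported_extend[of b] by presburger
    next
      fix t assume "t \<in> monomial_splits m"
      then obtain a b where t: "t = (a, b)" and ab: "(a, b) \<in> monomial_splits m"
        by (cases t) auto
      show "(case case t of (a, b) \<Rightarrow> (a \<circ> \<iota>, b \<circ> \<iota>) of (a, b) \<Rightarrow> (extend a, extend b)) = t"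
        using supported_split[OF ab] by (simp add: t extend_restrict)
      show "(case t of (a, b) \<Rightarrow> (a \<circ> \<iota>, b \<circ> \<iota>)) \<in> monomial_splits (m \<circ> \<iota>)"
        using ab by (auto simp: t monomial_splits_def)
    qed
    then show ?thesis
      using True by (simp add: mps_coeff_embed times_mps.rep_eq)
  next
    case False
    then have unsupported: "\<not> ?supported a \<or> \<not> ?supported b" if "(a, b) \<in> monomial_splits m" for a b
      using that by (auto simp: monomial_splits_def)
    have "mps_coeff (mps_embed \<iota> p) a * mps_coeff (mps_embed \<iota> q) b = 0"
      if "(a, b) \<in> monomial_splits m" for a b
      using unsupported[OF that]
      by (elim disjE) (simp_all only: mps_coeff_embed if_False mult_zero_left mult_zero_right)
    then have "mps_coeff (mps_embed \<iota> p * mps_embed \<iota> q) m = 0"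
      by (auto simp: times_mps.rep_eq intro!: sum.neutral)
    with False show ?thesis
      by (auto simp: mps_coeff_embed)
  qed
qed

lemma comm_ring_hom_mps_embed:
  fixes \<iota> :: "'v::finite \<Rightarrow> 'w::finite"
  assumes "inj \<iota>"
  shows "comm_ring_hom (mps_embed \<iota> :: ('v, 'k::comm_ring_1) mps \<Rightarrow> ('w, 'k) mps)"
proof
  show "mps_embed \<iota> (1 :: ('v, 'k) mps) = 1"
  proof (rule mps_eqI)
    fix m :: "'w \<Rightarrow> nat"
    have "m = (\<lambda>_. 0) \<longleftrightarrow> (\<forall>j. j \<notin> range \<iota> \<longrightarrow> m j = 0) \<and> m \<circ> \<iota> = (\<lambda>_. 0)"
      by (auto simp: fun_eq_iff) (metis rangeE)
    then show "mps_coeff (mps_embed \<iota> (1 :: ('v, 'k) mps)) m = mps_coeff 1 m"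
      unfolding mps_coeff_embed one_mps.rep_eq by (simp only:) auto
  qed
  show "mps_embed \<iota> (p + q) = mps_embed \<iota> p + mps_embed \<iota> q" for p q :: "('v, 'k) mps"
    by (rule mps_eqI) (auto simp: mps_coeff_embed plus_mps.rep_eq)
  show "mps_embed \<iota> (0 :: ('v, 'k) mps) = 0"
    by (rule mps_eqI) (simp add: mps_coeff_embed zero_mps.rep_eq)
qed (use assms in \<open>simp add: mps_embed_mult\<close>)


lemma (in semiring_hom) mat_hom_smult: "map_mat hom (c \<cdot>\<^sub>m A) = hom c \<cdot>\<^sub>m map_mat hom A"
  by (rule eq_matI) (simp_all add: hom_mult)


section \<open>Kronecker products\<close>

lemma kronecker_carrier [simp]:
  "\<lbrakk>A \<in> carrier_mat p q; B \<in> carrier_mat s t\<rbrakk> \<Longrightarrow> A \<otimes>\<^sub>k B \<in> carrier_mat (p * s) (q * t)"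
  by (auto simp: kronecker_def)

lemma dim_kronecker [simp]:
  "dim_row (A \<otimes>\<^sub>k B) = dim_row A * dim_row B" "dim_col (A \<otimes>\<^sub>k B) = dim_col A * dim_col B"
  by (simp_all add: kronecker_def)

lemma div_mod_bounds:
  fixes i n m :: nat
  assumes "i < n * m"
  shows "i div m < n" and "i mod m < m"
proof -
  from assms have "m > 0"
    by (cases m) auto
  with assms show "i div m < n" "i mod m < m"
    by (simp_all add: less_mult_imp_div_less)
qed

lemma index_kronecker:
  "\<lbrakk>i < dim_row A * dim_row B; j < dim_col A * dim_col B\<rbrakk> \<Longrightarrow>
    (A \<otimes>\<^sub>k B) $$ (i, j) =
      A $$ (i div dim_row B, j div dim_col B) * B $$ (i mod dim_row B, j mod dim_col B)"
  by (simp add: kronecker_def)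

lemma sum_div_mod:
  fixes F :: "nat \<Rightarrow> nat \<Rightarrow> 'a::comm_monoid_add"
  shows "(\<Sum>k<q * t. F (k div t) (k mod t)) = (\<Sum>i<q. \<Sum>j<t. F i j)"
proof -
  have bound: "i * t + j < q * t" if "i < q" "j < t" for i j
  proof -
    have "i * t + j < Suc i * t"
      using that by simp
    also have "\<dots> \<le> q * t"
      using that by (intro mult_le_mono1) simp
    finally show ?thesis .
  qed
  have "(\<Sum>k<q * t. F (k div t) (k mod t)) = (\<Sum>(i, j)\<in>{..<q} \<times> {..<t}. F i j)"
    by (rule sum.reindex_bij_witness[where j = "\<lambda>k. (k div t, k mod t)" and i = "\<lambda>(i, j). i * t + j"])
      (auto simp: bound div_mod_bounds)
  then show ?thesis
    by (simp add: sum.cartesian_product)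
qed

text \<open>
  The mixed product rule: the summation index of the left-hand side is a pair, encoded by quotient and
  remainder, and the double sum factors.
\<close>

lemma kronecker_mult:
  fixes A B C D :: "'a::comm_ring_1 mat"
  assumes A: "A \<in> carrier_mat p q" and B: "B \<in> carrier_mat s t"
    and C: "C \<in> carrier_mat q u" and D: "D \<in> carrier_mat t v"
  shows "(A \<otimes>\<^sub>k B) * (C \<otimes>\<^sub>k D) = (A * C) \<otimes>\<^sub>k (B * D)"
proof (rule eq_matI)
  fix i j
  assume "i < dim_row ((A * C) \<otimes>\<^sub>k (B * D))" and "j < dim_col ((A * C) \<otimes>\<^sub>k (B * D))"
  with assms have i: "i < p * s" and j: "j < u * v"
    by auto
  note bounds = div_mod_bounds[OF i] div_mod_bounds[OF j]
  have dims: "dim_row A = p" "dim_col A = q" "dim_row B = s" "dim_col B = t"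
    "dim_row C = q" "dim_col C = u" "dim_row D = t" "dim_col D = v"
    using assms by auto
  let ?i = "i div s" and ?i' = "i mod s" and ?j = "j div v" and ?j' = "j mod v"
  have "((A \<otimes>\<^sub>k B) * (C \<otimes>\<^sub>k D)) $$ (i, j) =
      (\<Sum>k<q * t. A $$ (?i, k div t) * B $$ (?i', k mod t) * (C $$ (k div t, ?j) * D $$ (k mod t, ?j')))"
    using i j by (simp add: scalar_prod_def index_kronecker dims atLeast0LessThan)
  also have "\<dots> = (\<Sum>k<q. \<Sum>l<t. A $$ (?i, k) * B $$ (?i', l) * (C $$ (k, ?j) * D $$ (l, ?j')))"
    by (rule sum_div_mod)
  also have "\<dots> = (\<Sum>k<q. A $$ (?i, k) * C $$ (k, ?j)) * (\<Sum>l<t. B $$ (?i', l) * D $$ (l, ?j'))"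
    by (simp add: sum_product mult_ac)
  also have "\<dots> = (A * C) $$ (?i, ?j) * (B * D) $$ (?i', ?j')"
    using bounds by (simp add: scalar_prod_def dims atLeast0LessThan)
  also have "\<dots> = ((A * C) \<otimes>\<^sub>k (B * D)) $$ (i, j)"
    using i j by (simp add: index_kronecker dims)
  finally show "((A \<otimes>\<^sub>k B) * (C \<otimes>\<^sub>k D)) $$ (i, j) = ((A * C) \<otimes>\<^sub>k (B * D)) $$ (i, j)" .
qed (use assms in auto)

lemma kronecker_one: "1\<^sub>m n \<otimes>\<^sub>k 1\<^sub>m m = (1\<^sub>m (n * m) :: 'a::comm_ring_1 mat)"
proof (rule eq_matI)
  fix i j assume ij: "i < dim_row (1\<^sub>m (n * m) :: 'a mat)" "j < dim_col (1\<^sub>m (n * m) :: 'a mat)"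
  have "i = j" if "i div m = j div m" "i mod m = j mod m"
    using that by (metis div_mult_mod_eq)
  then show "(1\<^sub>m n \<otimes>\<^sub>k 1\<^sub>m m) $$ (i, j) = (1\<^sub>m (n * m) :: 'a mat) $$ (i, j)"
    using ij div_mod_bounds[of i n m] div_mod_bounds[of j n m] by (auto simp: index_kronecker)
qed simp_all

lemma kronecker_smult_left: "(c \<cdot>\<^sub>m A) \<otimes>\<^sub>k B = c \<cdot>\<^sub>m (A \<otimes>\<^sub>k (B :: 'a::comm_ring_1 mat))"
  by (rule eq_matI) (auto simp: index_kronecker div_mod_bounds mult_ac)

lemma kronecker_smult_right: "A \<otimes>\<^sub>k (c \<cdot>\<^sub>m B) = c \<cdot>\<^sub>m (A \<otimes>\<^sub>k (B :: 'a::comm_ring_1 mat))"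
  by (rule eq_matI) (auto simp: index_kronecker div_mod_bounds mult_ac)

lemma kronecker_uminus_left: "- A \<otimes>\<^sub>k B = - (A \<otimes>\<^sub>k (B :: 'a::comm_ring_1 mat))"
  by (rule eq_matI) (auto simp: index_kronecker div_mod_bounds)

text \<open>
  Both sides equal \<open>A \<otimes> B\<close>. This is the source of all commutation relations below; for rectangular
  matrices the sizes of the identity matrices differ on the two sides.
\<close>

lemma kronecker_interchange:
  fixes A B :: "'a::comm_ring_1 mat"
  assumes "A \<in> carrier_mat p q" and "B \<in> carrier_mat s t"
  shows "(A \<otimes>\<^sub>k 1\<^sub>m s) * (1\<^sub>m q \<otimes>\<^sub>k B) = (1\<^sub>m p \<otimes>\<^sub>k B) * (A \<otimes>\<^sub>k 1\<^sub>m t)"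
  using assms by (simp add: kronecker_mult[of _ p q _ s s _ q _ t] kronecker_mult[of _ p p _ s t _ q _ t])


section \<open>The variants of the tensor product\<close>

interpretation in_x: comm_ring_hom
  "mps_embed Inl :: ('r::finite, 'k::field) mps \<Rightarrow> ('r + 's::finite, 'k) mps"
  by (rule comm_ring_hom_mps_embed) simp

interpretation in_y: comm_ring_hom
  "mps_embed Inr :: ('s::finite, 'k::field) mps \<Rightarrow> ('r::finite + 's, 'k) mps"
  by (rule comm_ring_hom_mps_embed) simp

lemma tensor_variant1_koszul:
  fixes X :: "('r::finite, 'k::field) mps mat_pair" and X' :: "('s::finite, 'k) mps mat_pair"
  shows "tensor_variant1 X X' =
    koszul_pair (in_x (fst X) \<otimes>\<^sub>k 1\<^sub>m (mf_size X')) (in_x (snd X) \<otimes>\<^sub>k 1\<^sub>m (mf_size X'))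
                (1\<^sub>m (mf_size X) \<otimes>\<^sub>k in_y (fst X')) (1\<^sub>m (mf_size X) \<otimes>\<^sub>k in_y (snd X'))"
  by (simp add: tensor_variant1_def koszul_pair_def Let_def kronecker_uminus_left)

lemma mf_size_tensor_variant1:
  assumes "X' \<in> Obj (MF g)"
  shows "mf_size (tensor_variant1 X X') = mf_size X * mf_size X' + mf_size X * mf_size X'"
  using assms by (elim Obj_MF_cases) (simp add: tensor_variant1_koszul koszul_pair_def mf_size_def)

lemma tensor_variant1_in_Obj:
  fixes f :: "('r::finite, 'k::field) mps" and g :: "('s::finite, 'k) mps"
  assumes "X \<in> Obj (MF f)" and "X' \<in> Obj (MF g)"
  shows "tensor_variant1 X X' \<in> Obj (MF (mps_embed Inl f + mps_embed Inr g))"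
proof -
  from assms(1) obtain n \<phi> \<psi> where X: "X = (\<phi>, \<psi>)"
    and [simp]: "\<phi> \<in> carrier_mat n n" "\<psi> \<in> carrier_mat n n"
    and f: "\<phi> * \<psi> = f \<cdot>\<^sub>m 1\<^sub>m n" "\<psi> * \<phi> = f \<cdot>\<^sub>m 1\<^sub>m n"
    by (rule Obj_MF_cases)
  from assms(2) obtain m \<phi>' \<psi>' where X': "X' = (\<phi>', \<psi>')"
    and [simp]: "\<phi>' \<in> carrier_mat m m" "\<psi>' \<in> carrier_mat m m"
    and g: "\<phi>' * \<psi>' = g \<cdot>\<^sub>m 1\<^sub>m m" "\<psi>' * \<phi>' = g \<cdot>\<^sub>m 1\<^sub>m m"
    by (rule Obj_MF_cases)
  have left: "(in_x A \<otimes>\<^sub>k 1\<^sub>m m) * (in_x B \<otimes>\<^sub>k 1\<^sub>m m) =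
      (mps_embed Inl f \<cdot>\<^sub>m 1\<^sub>m (n * m) :: ('r + 's, 'k) mps mat)"
    if "A * B = f \<cdot>\<^sub>m 1\<^sub>m n" "A \<in> carrier_mat n n" "B \<in> carrier_mat n n" for A B
    using that
    by (simp add: kronecker_mult[of _ n n _ m m _ n _ m] in_x.mat_hom_mult[of _ n n _ n, symmetric]
        in_x.mat_hom_smult in_x.mat_hom_one kronecker_smult_left kronecker_one)
  have right: "(1\<^sub>m n \<otimes>\<^sub>k in_y A) * (1\<^sub>m n \<otimes>\<^sub>k in_y B) =
      (mps_embed Inr g \<cdot>\<^sub>m 1\<^sub>m (n * m) :: ('r + 's, 'k) mps mat)"
    if "A * B = g \<cdot>\<^sub>m 1\<^sub>m m" "A \<in> carrier_mat m m" "B \<in> carrier_mat m m" for A B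
    using that
    by (simp add: kronecker_mult[of _ n n _ m m _ n _ m] in_y.mat_hom_mult[of _ m m _ m, symmetric]
        in_y.mat_hom_smult in_y.mat_hom_one kronecker_smult_right kronecker_one)
  show ?thesis
    unfolding tensor_variant1_koszul X X'
    by (rule koszul_pair_in_Obj[of _ "n * m"])
      (simp_all add: mf_size_eq[of _ n] mf_size_eq[of _ m] left right f g
        kronecker_interchange[of _ n n _ m m])
qed

text \<open>
  With \<open>(diag(\<alpha>, \<beta>), diag(\<beta>, \<alpha>))\<close> the blocks \<open>c\<close> and \<open>d\<close>, which come from the second argument, meet both
  \<open>\<alpha>\<close> and \<open>\<beta>\<close>, whereas each block \<open>a\<close> or \<open>b\<close> has the same matrix on its two sides and commutes with it.
\<close>

lemma defines_functor_tensor_variant1_right: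
  fixes f :: "('r::finite, 'k::field) mps" and g :: "('s::finite, 'k) mps"
  assumes X: "X \<in> Obj (MF f)"
  shows "defines_functor (MF g) (MF (mps_embed Inl f + mps_embed Inr g)) (\<lambda>X'. tensor_variant1 X X')"
proof -
  from X obtain n \<phi> \<psi> where X_eq: "X = (\<phi>, \<psi>)"
    and [simp]: "\<phi> \<in> carrier_mat n n" "\<psi> \<in> carrier_mat n n"
    by (rule Obj_MF_cases)
  define L :: "('s, 'k) mps mat \<Rightarrow> ('r + 's, 'k) mps mat" where "L A = 1\<^sub>m n \<otimes>\<^sub>k in_y A" for A
  have L_carrier [simp]: "L A \<in> carrier_mat (n * p) (n * q)" if "A \<in> carrier_mat p q" for A p q
    using that by (simp add: L_def)
  have L_mult: "L (A * B) = L A * L B" if "A \<in> carrier_mat p q" "B \<in> carrier_mat q s" for A B p q s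
    using that by (simp add: L_def kronecker_mult[of _ n n _ p q _ n _ s] in_y.mat_hom_mult)
  have L_one: "L (1\<^sub>m p) = 1\<^sub>m (n * p)" for p
    by (simp add: L_def in_y.mat_hom_one kronecker_one)
  have L_interchange: "(in_x A \<otimes>\<^sub>k 1\<^sub>m p) * L B = L B * (in_x A \<otimes>\<^sub>k 1\<^sub>m q)"
    if "A \<in> carrier_mat n n" "B \<in> carrier_mat p q" for A B p q
    using that by (simp add: L_def kronecker_interchange[of _ n n _ p q])
  show ?thesis
  proof (rule defines_functor_block_diag[where L = L and s = "\<lambda>p. n * p"
        and i = fst and j = snd and i' = snd and j' = fst])
    fix Y assume Y: "Y \<in> Obj (MF g)"
    with X show "tensor_variant1 X Y \<in> Obj (MF (mps_embed Inl f + mps_embed Inr g))"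
      by (rule tensor_variant1_in_Obj)
    from Y show "mf_size (tensor_variant1 X Y) = n * mf_size Y + n * mf_size Y"
      by (simp add: mf_size_tensor_variant1 X_eq mf_size_eq[of _ n])
  next
    fix Y Z u
    assume Y: "Y \<in> Obj (MF g)" and Z: "Z \<in> Obj (MF g)" and u: "u \<in> Hom (MF g) Y Z"
    from Y obtain p \<phi>\<^sub>1 \<psi>\<^sub>1 where Y_eq: "Y = (\<phi>\<^sub>1, \<psi>\<^sub>1)"
      and [simp]: "\<phi>\<^sub>1 \<in> carrier_mat p p" "\<psi>\<^sub>1 \<in> carrier_mat p p"
      by (rule Obj_MF_cases)
    from Z obtain q \<phi>\<^sub>2 \<psi>\<^sub>2 where Z_eq: "Z = (\<phi>\<^sub>2, \<psi>\<^sub>2)"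
      and [simp]: "\<phi>\<^sub>2 \<in> carrier_mat q q" "\<psi>\<^sub>2 \<in> carrier_mat q q"
      by (rule Obj_MF_cases)
    obtain \<alpha> \<beta> where u_eq: "u = (\<alpha>, \<beta>)"
      by (cases u)
    from u have [simp]: "\<alpha> \<in> carrier_mat q p" "\<beta> \<in> carrier_mat q p"
      and eqs: "\<alpha> * \<phi>\<^sub>1 = \<phi>\<^sub>2 * \<beta>" "\<psi>\<^sub>2 * \<alpha> = \<beta> * \<psi>\<^sub>1"
      by (simp_all add: Y_eq Z_eq u_eq Hom_MF_iff[of _ p _ q])
    have "L \<alpha> * L \<phi>\<^sub>1 = L \<phi>\<^sub>2 * L \<beta>" "L \<psi>\<^sub>2 * L \<alpha> = L \<beta> * L \<psi>\<^sub>1"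
      using eqs by (simp_all add: L_mult[of _ q p _ p, symmetric] L_mult[of _ q q _ p, symmetric])
    then show "(block_diag (L (fst u)) (L (snd u)), block_diag (L (snd u)) (L (fst u))) \<in>
        Hom (MF (mps_embed Inl f + mps_embed Inr g)) (tensor_variant1 X Y) (tensor_variant1 X Z)"
      unfolding tensor_variant1_koszul
      by (intro koszul_pair_Hom[of _ "n * p" _ _ _ _ "n * q"])
        (simp_all add: X_eq Y_eq Z_eq u_eq mf_size_eq[of _ n] mf_size_eq[of _ p] mf_size_eq[of _ q]
          L_def[symmetric] L_interchange[of _ _ q p])
  qed (use L_mult L_one in simp_all)
qed

text \<open>
  Here the diagonal blocks \<open>c\<close> and \<open>d\<close> have to commute with the morphism, so both diagonal matrices are
  taken equal; the order \<open>diag(\<beta>, \<alpha>)\<close> is dictated by \<open>b = \<psi> \<otimes> 1\<close>, which stands in the upper right corner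
  and satisfies \<open>\<beta> \<psi>\<^sub>1 = \<psi>\<^sub>2 \<alpha>\<close>.
\<close>

lemma defines_functor_tensor_variant1_left:
  fixes f :: "('r::finite, 'k::field) mps" and g :: "('s::finite, 'k) mps"
  assumes X': "X' \<in> Obj (MF g)"
  shows "defines_functor (MF f) (MF (mps_embed Inl f + mps_embed Inr g)) (\<lambda>X. tensor_variant1 X X')"
proof -
  from X' obtain m \<phi>' \<psi>' where X'_eq: "X' = (\<phi>', \<psi>')"
    and [simp]: "\<phi>' \<in> carrier_mat m m" "\<psi>' \<in> carrier_mat m m"
    by (rule Obj_MF_cases)
  define L :: "('r, 'k) mps mat \<Rightarrow> ('r + 's, 'k) mps mat" where "L A = in_x A \<otimes>\<^sub>k 1\<^sub>m m" for A
  have L_carrier [simp]: "L A \<in> carrier_mat (p * m) (q * m)" if "A \<in> carrier_mat p q" for A p q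
    using that by (simp add: L_def)
  have L_mult: "L (A * B) = L A * L B" if "A \<in> carrier_mat p q" "B \<in> carrier_mat q s" for A B p q s
    using that by (simp add: L_def kronecker_mult[of _ p q _ m m _ s _ m] in_x.mat_hom_mult)
  have L_one: "L (1\<^sub>m p) = 1\<^sub>m (p * m)" for p
    by (simp add: L_def in_x.mat_hom_one kronecker_one)
  have L_interchange: "L A * (1\<^sub>m q \<otimes>\<^sub>k in_y B) = (1\<^sub>m p \<otimes>\<^sub>k in_y B) * L A"
    if "A \<in> carrier_mat p q" "B \<in> carrier_mat m m" for A B p q
    using that by (simp add: L_def kronecker_interchange[of _ p q _ m m])
  show ?thesis
  proof (rule defines_functor_block_diag[where L = L and s = "\<lambda>p. p * m"
        and i = snd and j = fst and i' = snd and j' = fst])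
    fix Y assume Y: "Y \<in> Obj (MF f)"
    then show "tensor_variant1 Y X' \<in> Obj (MF (mps_embed Inl f + mps_embed Inr g))"
      using X' by (rule tensor_variant1_in_Obj)
    from X' Y show "mf_size (tensor_variant1 Y X') = mf_size Y * m + mf_size Y * m"
      by (simp add: mf_size_tensor_variant1 X'_eq mf_size_eq[of _ m])
  next
    fix Y Z u
    assume Y: "Y \<in> Obj (MF f)" and Z: "Z \<in> Obj (MF f)" and u: "u \<in> Hom (MF f) Y Z"
    from Y obtain p \<phi>\<^sub>1 \<psi>\<^sub>1 where Y_eq: "Y = (\<phi>\<^sub>1, \<psi>\<^sub>1)"
      and [simp]: "\<phi>\<^sub>1 \<in> carrier_mat p p" "\<psi>\<^sub>1 \<in> carrier_mat p p"
      by (rule Obj_MF_cases)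
    from Z obtain q \<phi>\<^sub>2 \<psi>\<^sub>2 where Z_eq: "Z = (\<phi>\<^sub>2, \<psi>\<^sub>2)"
      and [simp]: "\<phi>\<^sub>2 \<in> carrier_mat q q" "\<psi>\<^sub>2 \<in> carrier_mat q q"
      by (rule Obj_MF_cases)
    obtain \<alpha> \<beta> where u_eq: "u = (\<alpha>, \<beta>)"
      by (cases u)
    from u have [simp]: "\<alpha> \<in> carrier_mat q p" "\<beta> \<in> carrier_mat q p"
      and eqs: "\<alpha> * \<phi>\<^sub>1 = \<phi>\<^sub>2 * \<beta>" "\<psi>\<^sub>2 * \<alpha> = \<beta> * \<psi>\<^sub>1"
      by (simp_all add: Y_eq Z_eq u_eq Hom_MF_iff[of _ p _ q])
    have "L \<alpha> * L \<phi>\<^sub>1 = L \<phi>\<^sub>2 * L \<beta>" "L \<psi>\<^sub>2 * L \<alpha> = L \<beta> * L \<psi>\<^sub>1"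
      using eqs by (simp_all add: L_mult[of _ q p _ p, symmetric] L_mult[of _ q q _ p, symmetric])
    then show "(block_diag (L (snd u)) (L (fst u)), block_diag (L (snd u)) (L (fst u)))
        \<in> Hom (MF (mps_embed Inl f + mps_embed Inr g)) (tensor_variant1 Y X') (tensor_variant1 Z X')"
      unfolding tensor_variant1_koszul
      by (intro koszul_pair_Hom[of _ "p * m" _ _ _ _ "q * m"])
        (simp_all add: X'_eq Y_eq Z_eq u_eq mf_size_eq[of _ m] mf_size_eq[of _ p] mf_size_eq[of _ q]
          L_def[symmetric] L_interchange[of _ q p])
  qed (use L_mult L_one in simp_all)
qed

text \<open>
  In the second variant \<open>\<phi> \<otimes> 1\<close> and \<open>\<psi> \<otimes> 1\<close> stand on the diagonal, which takes a permutation of blocks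
  on one side only. This permutation alone puts them there in the opposite order, hence the exchange
  of \<open>\<phi>\<close> and \<open>\<psi>\<close>.
\<close>

lemma tensor_variant2_eq:
  fixes X :: "('r::finite, 'k::field) mps mat_pair" and X' :: "('s::finite, 'k) mps mat_pair"
  assumes "X \<in> Obj (MF f)" and "X' \<in> Obj (MF g)"
  shows "tensor_variant2 X X' =
    (block_swap (mf_size X * mf_size X') * fst (tensor_variant1 (snd X, fst X) X'),
     snd (tensor_variant1 (snd X, fst X) X') * block_swap (mf_size X * mf_size X'))"
proof -
  from assms(1) obtain n \<phi> \<psi> where X: "X = (\<phi>, \<psi>)"
    and [simp]: "\<phi> \<in> carrier_mat n n" "\<psi> \<in> carrier_mat n n"
    by (rule Obj_MF_cases)
  from assms(2) obtain m \<phi>' \<psi>' where X': "X' = (\<phi>', \<psi>')"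
    and [simp]: "\<phi>' \<in> carrier_mat m m" "\<psi>' \<in> carrier_mat m m"
    by (rule Obj_MF_cases)
  show ?thesis
    unfolding X X' tensor_variant1_koszul koszul_pair_def fst_conv snd_conv
    by (simp add: mf_size_eq[of _ n] mf_size_eq[of _ m] block_swap_mult_four_block
        four_block_mult_block_swap tensor_variant2_def Let_def kronecker_uminus_left)
qed

lemma tensor_variant3_eq:
  fixes X :: "('r::finite, 'k::field) mps mat_pair" and X' :: "('s::finite, 'k) mps mat_pair"
  assumes "X \<in> Obj (MF f)" and "X' \<in> Obj (MF g)"
  shows "tensor_variant3 X X' =
    (block_swap (mf_size X * mf_size X') * fst (tensor_variant1 X X') *
       block_swap (mf_size X * mf_size X'),
     block_swap (mf_size X * mf_size X') * snd (tensor_variant1 X X') *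
       block_swap (mf_size X * mf_size X'))"
proof -
  from assms(1) obtain n \<phi> \<psi> where X: "X = (\<phi>, \<psi>)"
    and [simp]: "\<phi> \<in> carrier_mat n n" "\<psi> \<in> carrier_mat n n"
    by (rule Obj_MF_cases)
  from assms(2) obtain m \<phi>' \<psi>' where X': "X' = (\<phi>', \<psi>')"
    and [simp]: "\<phi>' \<in> carrier_mat m m" "\<psi>' \<in> carrier_mat m m"
    by (rule Obj_MF_cases)
  show ?thesis
    unfolding X X' tensor_variant1_koszul koszul_pair_def fst_conv snd_conv
    by (simp add: mf_size_eq[of _ n] mf_size_eq[of _ m] block_swap_mult_four_block
        four_block_mult_block_swap tensor_variant3_def Let_def kronecker_uminus_left)
qed

lemma defines_functor_tensor_variant2:
  fixes f :: "('r::finite, 'k::field) mps" and g :: "('s::finite, 'k) mps"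
  shows "X \<in> Obj (MF f) \<Longrightarrow>
      defines_functor (MF g) (MF (mps_embed Inl f + mps_embed Inr g)) (\<lambda>X'. tensor_variant2 X X')"
    and "X' \<in> Obj (MF g) \<Longrightarrow>
      defines_functor (MF f) (MF (mps_embed Inl f + mps_embed Inr g)) (\<lambda>X. tensor_variant2 X X')"
proof -
  have swap: "(snd X, fst X) \<in> Obj (MF f)" "mf_size (snd X, fst X) = mf_size X"
    if "X \<in> Obj (MF f)" for X
    using that by (auto elim!: Obj_MF_cases simp: Obj_MF_iff mf_size_eq)
  let ?P = "\<lambda>X X'. block_swap (mf_size X * mf_size X') :: ('r + 's, 'k) mps mat"
  let ?Q = "\<lambda>X X'. 1\<^sub>m (mf_size X * mf_size X' + mf_size X * mf_size X') :: ('r + 's, 'k) mps mat"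
  \<comment> \<open>Only one side of each matrix is permuted, so the second involution is the identity.\<close>
  have eq: "tensor_variant2 X X' =
      (?P X X' * fst (tensor_variant1 (snd X, fst X) X') * ?Q X X',
       ?Q X X' * snd (tensor_variant1 (snd X, fst X) X') * ?P X X')"
    if X: "X \<in> Obj (MF f)" and X': "X' \<in> Obj (MF g)" for X and X'
  proof -
    let ?n = "mf_size X * mf_size X' + mf_size X * mf_size X'"
    have "tensor_variant1 (snd X, fst X) X' \<in> Obj (MF (mps_embed Inl f + mps_embed Inr g))"
      using X X' by (intro tensor_variant1_in_Obj swap)
    then have "fst (tensor_variant1 (snd X, fst X) X') \<in> carrier_mat ?n ?n"
      "snd (tensor_variant1 (snd X, fst X) X') \<in> carrier_mat ?n ?n"
      using mf_size_tensor_variant1[OF X', of "(snd X, fst X)"] swap(2)[OF X]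
      by (auto elim!: Obj_MF_cases simp: mf_size_eq)
    then show ?thesis
      by (simp add: tensor_variant2_eq[OF X X'] mult_carrier_mat[of _ ?n ?n]
          right_mult_one_mat[of _ ?n ?n] left_mult_one_mat[of _ ?n ?n])
  qed
  show "defines_functor (MF g) (MF (mps_embed Inl f + mps_embed Inr g)) (\<lambda>X'. tensor_variant2 X X')"
    if X: "X \<in> Obj (MF f)" for X
    by (rule defines_functor_equivalent[OF defines_functor_tensor_variant1_right[OF swap(1)[OF X]],
          where P = "?P X" and Q = "?Q X"])
      (simp_all add: mf_size_tensor_variant1 swap X block_swap_involution eq)
  show "defines_functor (MF f) (MF (mps_embed Inl f + mps_embed Inr g)) (\<lambda>X. tensor_variant2 X X')"
    if X': "X' \<in> Obj (MF g)" for X'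
    by (rule defines_functor_equivalent[OF defines_functor_compose[OF defines_functor_swap
            defines_functor_tensor_variant1_left[OF X']],
          where P = "\<lambda>X. ?P X X'" and Q = "\<lambda>X. ?Q X X'"])
      (simp_all add: mf_size_tensor_variant1[OF X'] swap X' block_swap_involution eq)
qed

lemma defines_functor_tensor_variant3:
  fixes f :: "('r::finite, 'k::field) mps" and g :: "('s::finite, 'k) mps"
  shows "X \<in> Obj (MF f) \<Longrightarrow>
      defines_functor (MF g) (MF (mps_embed Inl f + mps_embed Inr g)) (\<lambda>X'. tensor_variant3 X X')"
    and "X' \<in> Obj (MF g) \<Longrightarrow>
      defines_functor (MF f) (MF (mps_embed Inl f + mps_embed Inr g)) (\<lambda>X. tensor_variant3 X X')"
proof -
  let ?P = "\<lambda>X X'. block_swap (mf_size X * mf_size X') :: ('r + 's, 'k) mps mat"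
  show "defines_functor (MF g) (MF (mps_embed Inl f + mps_embed Inr g)) (\<lambda>X'. tensor_variant3 X X')"
    if X: "X \<in> Obj (MF f)" for X
    by (rule defines_functor_equivalent[OF defines_functor_tensor_variant1_right[OF X],
          where P = "?P X" and Q = "?P X"])
      (simp_all add: mf_size_tensor_variant1 block_swap_involution tensor_variant3_eq[OF X])
  show "defines_functor (MF f) (MF (mps_embed Inl f + mps_embed Inr g)) (\<lambda>X. tensor_variant3 X X')"
    if X': "X' \<in> Obj (MF g)" for X'
    by (rule defines_functor_equivalent[OF defines_functor_tensor_variant1_left[OF X'],
          where P = "\<lambda>X. ?P X X'" and Q = "\<lambda>X. ?P X X'"])
      (simp_all add: mf_size_tensor_variant1[OF X'] block_swap_involution tensor_variant3_eq[OF _ X'])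
qed

theorem proposition2p1:
  fixes f :: "('r::finite, 'k::field) mps" and g :: "('s::finite, 'k) mps"
  assumes "f \<noteq> 0" and "g \<noteq> 0"
  shows "\<forall>T \<in> {tensor_variant1, tensor_variant2, tensor_variant3}.
    (\<forall>X\<^sub>f \<in> Obj (MF f).
      defines_functor (MF g) (MF (mps_embed Inl f + mps_embed Inr g)) (\<lambda>X'. T X\<^sub>f X')) \<and>
    (\<forall>X\<^sub>g \<in> Obj (MF g).
      defines_functor (MF f) (MF (mps_embed Inl f + mps_embed Inr g)) (\<lambda>X. T X X\<^sub>g))"
  using defines_functor_tensor_variant1_left[of _ g f] defines_functor_tensor_variant1_right[of _ f g]
    defines_functor_tensor_variant2[of _ f g] defines_functor_tensor_variant2(2)[of _ g f]
    defines_functor_tensor_variant3[of _ f g] defines_functor_tensor_variant3(2)[of _ g f]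
  by auto

end
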